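(* Let $p\ge2$ and let $F:\mathbb{R}_+^p\to\mathbb{R}_+$ be continuous with $F(0)=0$ and $F(x)\ge F(x')$ whenever $x,x'\in\mathbb{R}_+^p$ and $x-x'\in\mathbb{R}_+^p$. For $\gamma\in\mathbb{R}_+$ let $L(\gamma):=\{x\in\mathbb{R}_+^p\mid F(x)\ge\gamma\}$, and let $\Gamma_F:=\{\gamma\in(0,\infty)\mid L(\gamma)\ne\emptyset\}$. (a) If $F$ is strictly quasiconcave on $\{x\in\mathbb{R}_+^p\mid F(x)>0\}$, then $\sigma_{L(\gamma)}$ is differentiable on $-\mathbb{R}_{++}^p$ for every $\gamma\in\Gamma_F$. (b) If $F(x)>F(x')$ for all $x,x'\in\mathbb{R}_+^p$ with $x-x'\in\mathbb{R}_+^p\setminus\{0\}$ and $F(x')>0$, and $\sigma_{L(\gamma)}$ is differentiable on $-\mathbb{R}_{++}^p$ for every $\gamma\in\Gamma_F$, then $F$ is quasiconcave.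
   Context: $\mathbb{R}_+=[0,\infty)$, $\mathbb{R}_{++}^p=(0,\infty)^p$, and $\mathbb{R}^p$ carries the Euclidean norm and is identified with its dual. The support function of a nonempty $A\subset\mathbb{R}^p$ is $\sigma_A(x^* ):=\sup\{\langle u,x^*\rangle\mid u\in A\}\in(-\infty,+\infty]$. $F$ is strictly quasiconcave on $S$ if $F(\lambda x+(1-\lambda)x')>\min\{F(x),F(x')\}$ for all $x,x'\in S$ with $x\neq x'$ and all $\lambda\in(0,1)$; $F$ is quasiconcave if $F(\lambda x+(1-\lambda)x')\ge\min\{F(x),F(x')\}$ for all $x,x'\in\mathbb{R}_+^p$ and $\lambda\in(0,1)$. *)

theory Defs
  imports "HOL-Analysis.Analysis"
begin

definition nonneg_orthant :: "(real ^ 'n) set" where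
  "nonneg_orthant = {x. \<forall>i. 0 \<le> x $ i}"

definition pos_orthant :: "(real ^ 'n) set" where
  "pos_orthant = {x. \<forall>i. 0 < x $ i}"

text \<open>Intended for nonempty \<open>A\<close> only; for \<open>A = {}\<close> the supremum in \<^typ>\<open>ereal\<close> is \<open>-\<infinity>\<close>.\<close>

definition support_function :: "'a::real_inner set \<Rightarrow> 'a \<Rightarrow> ereal" where
  "support_function A y = (SUP u\<in>A. ereal (inner u y))"

text \<open>Finiteness near \<open>x\<close> is part of differentiability, because \<^const>\<open>real_of_ereal\<close>
  maps \<open>\<plusminus>\<infinity>\<close> to \<open>0\<close>.\<close>

definition ereal_differentiable_at :: "('a::real_normed_vector \<Rightarrow> ereal) \<Rightarrow> 'a \<Rightarrow> bool" where
  "ereal_differentiable_at f x \<longleftrightarrow>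
     (\<forall>\<^sub>F y in nhds x. \<bar>f y\<bar> \<noteq> \<infinity>) \<and> (\<lambda>y. real_of_ereal (f y)) differentiable (at x)"

definition quasiconcave_on :: "'a::real_vector set \<Rightarrow> ('a \<Rightarrow> real) \<Rightarrow> bool" where
  "quasiconcave_on S F \<longleftrightarrow>
     (\<forall>x\<in>S. \<forall>x'\<in>S. \<forall>t\<in>{0<..<1}. F (t *\<^sub>R x + (1 - t) *\<^sub>R x') \<ge> min (F x) (F x'))"

text \<open>\<open>S\<close> is not required to be convex: \<open>F\<close> is also evaluated at convex combinations
  outside \<open>S\<close>.\<close>

definition strictly_quasiconcave_on :: "'a::real_vector set \<Rightarrow> ('a \<Rightarrow> real) \<Rightarrow> bool" where
  "strictly_quasiconcave_on S F \<longleftrightarrow>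
     (\<forall>x\<in>S. \<forall>x'\<in>S. x \<noteq> x' \<longrightarrow>
        (\<forall>t\<in>{0<..<1}. F (t *\<^sub>R x + (1 - t) *\<^sub>R x') > min (F x) (F x')))"

definition upper_level_set :: "(real ^ 'n \<Rightarrow> real) \<Rightarrow> real \<Rightarrow> (real ^ 'n) set" where
  "upper_level_set F \<gamma> = {x \<in> nonneg_orthant. F x \<ge> \<gamma>}"

definition positive_levels :: "(real ^ 'n \<Rightarrow> real) \<Rightarrow> real set" where
  "positive_levels F = {\<gamma>. 0 < \<gamma> \<and> upper_level_set F \<gamma> \<noteq> {}}"

end

theory Submission
  imports Defs
begin

text \<open>Both parts rest on Danskin's correspondence: as long as maximisers of linear functionals exist
  and stay bounded near \<open>y\<close>, the support function of a closed set is differentiable at \<open>y\<close> exactly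
  when \<open>\<langle>\<cdot>, y\<rangle>\<close> has a single maximiser over the closed convex hull, which is then the gradient.
  For \<open>y\<close> with strictly negative entries maximisers over a closed part of the orthant exist and
  stay bounded, locally uniformly in \<open>y\<close> (\<open>locally_bounded_maximisers\<close>).

  For the first part, two distinct maximisers over a level set would have a midpoint at which \<open>F\<close>
  exceeds the level strictly. By continuity the midpoint can be moved a little towards the origin
  inside the level set, which increases the functional; so the maximiser is unique and
  \<open>differentiable_if_unique_maximiser\<close> applies.

  For the second part, differentiability forces every maximiser, at a strictly negative
  \<open>y\<close>, over the closed convex hull of a level set \<open>L\<close> to lie in
  \<open>L\<close> itself (\<open>unique_maximiser_if_differentiable\<close>). Only points exposed
  by strictly negative functionals are controlled in this way, but they suffice: whenever a point
  \<open>z\<close> of the convex hull is enlarged in all entries by some \<open>e > 0\<close>, an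
  exposed point of this kind lies below the enlarged point
  (\<open>level_point_below_hull_point\<close>). It is found by minimising over the hull a convex
  function whose gradient is strictly positive everywhere and which exceeds its value at
  \<open>z\<close> outside the region below the enlarged point. Monotonicity and continuity of
  \<open>F\<close> then put \<open>z\<close> in \<open>L\<close>, so that \<open>L\<close> is
  convex.\<close>

section \<open>Differentiability of support functions\<close>

lemma support_function_eq_maximum:
  assumes "x \<in> A" "\<And>u. u \<in> A \<Longrightarrow> inner u y \<le> inner x y"
  shows "support_function A y = ereal (inner x y)"
  unfolding support_function_def
  by (rule antisym) (use assms in \<open>auto intro!: SUP_least SUP_upper\<close>)

text \<open>If maximisers at nearby \<open>y\<close> failed to approach the unique maximiser at \<open>y0\<close>, they would stay
  in a compact set on which the functional at \<open>y0\<close> has a strictly smaller maximum.\<close>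

lemma maximisers_tend_to_unique_maximiser:
  fixes A :: "'a::euclidean_space set"
  assumes cl: "closed A" and x0: "x0 \<in> A"
    and uniq: "\<And>x. x \<in> A \<Longrightarrow> x \<noteq> x0 \<Longrightarrow> inner x y0 < inner x0 y0"
    and "e > 0"
  shows "\<exists>d>0. \<forall>y. norm (y - y0) < d \<longrightarrow>
           (\<forall>x\<in>A \<inter> cball 0 R. inner x0 y \<le> inner x y \<longrightarrow> norm (x - x0) < e)"
proof -
  define K where "K = A \<inter> cball 0 R - ball x0 e"
  have "compact K"
    unfolding K_def by (intro compact_diff closed_Int_compact cl compact_cball open_ball)
  show ?thesis
  proof (cases "K = {}")
    case True
    then show ?thesis
      by (intro exI[of _ 1]) (auto simp: K_def dist_norm norm_minus_commute)
  next
    case False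
    have "continuous_on K (\<lambda>u. inner u y0)" by (intro continuous_intros)
    then obtain m where m: "m \<in> K" "\<And>u. u \<in> K \<Longrightarrow> inner u y0 \<le> inner m y0"
      using continuous_attains_sup[OF \<open>compact K\<close> False] by blast
    have "m \<in> A" "m \<noteq> x0" using m(1) \<open>e > 0\<close> by (auto simp: K_def)
    then have gap: "0 < inner x0 y0 - inner m y0" using uniq by simp
    define D where "D = \<bar>R\<bar> + norm x0 + 1"
    have "D > 0" by (simp add: D_def add_nonneg_pos)
    show ?thesis
    proof (intro exI[of _ "(inner x0 y0 - inner m y0) / D"] conjI allI impI ballI)
      show "0 < (inner x0 y0 - inner m y0) / D" using gap \<open>D > 0\<close> by simp
      fix y x
      assume y: "norm (y - y0) < (inner x0 y0 - inner m y0) / D"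
        and x: "x \<in> A \<inter> cball 0 R" and le: "inner x0 y \<le> inner x y"
      show "norm (x - x0) < e"
      proof (rule ccontr)
        assume "\<not> norm (x - x0) < e"
        with x have "x \<in> K" by (simp add: K_def dist_norm norm_minus_commute)
        then have "inner x0 y0 - inner m y0 \<le> inner (x0 - x) y0"
          using m(2) by (simp add: inner_diff_left)
        also have "\<dots> \<le> inner (x - x0) (y - y0)"
          using le by (simp add: inner_diff_left inner_diff_right)
        also have "\<dots> \<le> norm (x - x0) * norm (y - y0)" by (rule norm_cauchy_schwarz)
        also have "\<dots> \<le> D * norm (y - y0)"
        proof (rule mult_right_mono)
          show "norm (x - x0) \<le> D"
            using x norm_triangle_ineq4[of x x0] by (auto simp: D_def)
        qed simp
        also have "\<dots> < inner x0 y0 - inner m y0"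
          using y \<open>D > 0\<close> by (simp add: field_simps)
        finally show False by simp
      qed
    qed
  qed
qed

text \<open>If \<open>x\<close> and \<open>x0\<close> maximise the functionals at \<open>y\<close> and \<open>y0\<close>, then comparing each functional at
  both points traps the increment of the support function between \<open>\<langle>x0, y - y0\<rangle>\<close> and
  \<open>\<langle>x, y - y0\<rangle>\<close>. So \<open>x0\<close> is the gradient as soon as \<open>x\<close> tends to \<open>x0\<close>.\<close>

lemma differentiable_if_unique_maximiser:
  fixes A :: "'a::euclidean_space set"
  assumes cl: "closed A" and "r > 0"
    and ex: "\<And>y. y \<in> ball y0 r \<Longrightarrow> \<exists>x\<in>A \<inter> cball 0 R. \<forall>u\<in>A. inner u y \<le> inner x y"
    and uniq: "\<And>x x'. \<lbrakk>x \<in> A; x' \<in> A; \<forall>u\<in>A. inner u y0 \<le> inner x y0;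
                  \<forall>u\<in>A. inner u y0 \<le> inner x' y0\<rbrakk> \<Longrightarrow> x = x'"
  shows "ereal_differentiable_at (support_function A) y0"
proof -
  obtain X where X: "\<And>y. y \<in> ball y0 r \<Longrightarrow> X y \<in> A \<inter> cball 0 R"
    and Xmax: "\<And>y u. y \<in> ball y0 r \<Longrightarrow> u \<in> A \<Longrightarrow> inner u y \<le> inner (X y) y"
    using ex by metis
  have supp: "support_function A y = ereal (inner (X y) y)" if "y \<in> ball y0 r" for y
    using support_function_eq_maximum[of "X y" A y] X Xmax that by blast
  define x0 where "x0 = X y0"
  have y0: "y0 \<in> ball y0 r" using \<open>r > 0\<close> by simp
  have x0: "x0 \<in> A" using X[OF y0] by (simp add: x0_def)
  have strict: "inner x y0 < inner x0 y0" if "x \<in> A" "x \<noteq> x0" for x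
  proof (rule ccontr)
    assume "\<not> inner x y0 < inner x0 y0"
    then have "\<forall>u\<in>A. inner u y0 \<le> inner x y0"
      using Xmax[OF y0] unfolding x0_def by fastforce
    then show False using uniq[OF \<open>x \<in> A\<close> x0] Xmax[OF y0] that unfolding x0_def by blast
  qed
  have fin: "\<forall>\<^sub>F y in nhds y0. \<bar>support_function A y\<bar> \<noteq> \<infinity>"
    using eventually_nhds_in_open[OF open_ball y0] by eventually_elim (simp add: supp)
  have "((\<lambda>y. real_of_ereal (support_function A y)) has_derivative (\<lambda>h. inner x0 h)) (at y0)"
    unfolding has_derivative_at_alt
  proof (intro conjI allI impI)
    show "bounded_linear (inner x0)" by (rule bounded_linear_inner_right)
    fix e :: real assume "e > 0"
    obtain d where d: "d > 0"
      "\<And>y x. norm (y - y0) < d \<Longrightarrow> x \<in> A \<inter> cball 0 R \<Longrightarrow> inner x0 y \<le> inner x y \<Longrightarrow> norm (x - x0) < e"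
      using maximisers_tend_to_unique_maximiser[OF cl x0 strict \<open>e > 0\<close>, of R] by blast
    show "\<exists>d>0. \<forall>y. norm (y - y0) < d \<longrightarrow>
           norm (real_of_ereal (support_function A y) - real_of_ereal (support_function A y0)
             - inner x0 (y - y0)) \<le> e * norm (y - y0)"
    proof (intro exI[of _ "min d r"] conjI allI impI)
      show "min d r > 0" using d(1) \<open>r > 0\<close> by simp
      fix y assume y: "norm (y - y0) < min d r"
      then have yb: "y \<in> ball y0 r" by (simp add: dist_norm norm_minus_commute)
      have near: "norm (X y - x0) < e" using d(2)[OF _ X[OF yb] Xmax[OF yb x0]] y by simp
      have lo: "0 \<le> inner (X y) y - inner x0 y" using Xmax[OF yb x0] by simp
      have hi: "inner (X y) y0 \<le> inner x0 y0"
        using Xmax[OF y0, of "X y"] X[OF yb] by (simp add: x0_def)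
      have eq: "real_of_ereal (support_function A y) - real_of_ereal (support_function A y0)
             - inner x0 (y - y0) = inner (X y) y - inner x0 y"
        using supp[OF yb] supp[OF y0] by (simp add: x0_def inner_diff_right)
      have "inner (X y) y - inner x0 y \<le> inner (X y - x0) (y - y0)"
        using hi by (simp add: inner_diff_left inner_diff_right)
      also have "\<dots> \<le> norm (X y - x0) * norm (y - y0)" by (rule norm_cauchy_schwarz)
      also have "\<dots> \<le> e * norm (y - y0)" using near by (intro mult_right_mono) auto
      finally show "norm (real_of_ereal (support_function A y) - real_of_ereal (support_function A y0)
             - inner x0 (y - y0)) \<le> e * norm (y - y0)"
        using lo eq by simp
    qed
  qed
  then show ?thesis using fin unfolding ereal_differentiable_at_def differentiable_def by blast
qed

text \<open>Every halfspace that contains \<open>A\<close> also contains its closed convex hull. Hence a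
  maximiser \<open>u\<close> over the hull at \<open>y\<close> makes \<open>\<langle>u, \<cdot>\<rangle>\<close> a minorant of the support function of \<open>A\<close> that
  touches it at \<open>y\<close>, and so \<open>u\<close> is the gradient at \<open>y\<close>.\<close>

lemma unique_maximiser_if_differentiable:
  fixes A :: "'a::real_inner set"
  assumes diff: "ereal_differentiable_at (support_function A) y"
    and uv: "u \<in> closure (convex hull A)" "v \<in> closure (convex hull A)"
    and max: "support_function A y = ereal (inner u y)" "support_function A y = ereal (inner v y)"
  shows "u = v"
proof -
  define s where "s = (\<lambda>z. real_of_ereal (support_function A z))"
  from diff have fin: "\<forall>\<^sub>F z in nhds y. \<bar>support_function A z\<bar> \<noteq> \<infinity>"
    and "\<exists>D. (s has_derivative D) (at y)"
    unfolding ereal_differentiable_at_def differentiable_def s_def by auto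
  then obtain D where D: "(s has_derivative D) (at y)" by blast
  have hull_le: "inner w z \<le> s z"
    if "\<bar>support_function A z\<bar> \<noteq> \<infinity>" "w \<in> closure (convex hull A)" for w z
  proof -
    from that have sz: "support_function A z = ereal (s z)" by (simp add: s_def ereal_real)
    have "A \<subseteq> {w. inner z w \<le> s z}"
    proof
      fix a assume "a \<in> A"
      then have "ereal (inner a z) \<le> ereal (s z)"
        unfolding sz[symmetric] support_function_def by (rule SUP_upper)
      then show "a \<in> {w. inner z w \<le> s z}" by (simp add: inner_commute)
    qed
    then have "closure (convex hull A) \<subseteq> {w. inner z w \<le> s z}"
      by (intro closure_minimal hull_minimal convex_halfspace_le closed_halfspace_le)
    with that show ?thesis by (auto simp: inner_commute)
  qed
  have gradient: "D = inner w"
    if w: "w \<in> closure (convex hull A)" "support_function A y = ereal (inner w y)" for w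
  proof -
    have "((\<lambda>z. s z - inner w z) has_derivative (\<lambda>h. D h - inner w h)) (at y)"
      by (intro derivative_intros D)
    moreover have "\<forall>\<^sub>F z in at y. s y - inner w y \<le> s z - inner w z"
    proof (rule eventually_at_filter[THEN iffD2], use fin in eventually_elim)
      case (elim z)
      then show ?case using hull_le[OF elim w(1)] w(2) by (simp add: s_def)
    qed
    ultimately have "(\<lambda>h. D h - inner w h) = (\<lambda>h. 0)" by (rule has_derivative_local_min)
    then show ?thesis by (auto simp: fun_eq_iff)
  qed
  have "inner u = inner v" using gradient uv max by metis
  then have "inner (u - v) (u - v) = 0" by (simp add: inner_diff_left)
  then show ?thesis by simp
qed

section \<open>Closed subsets of the nonnegative orthant\<close>

lemma closed_nonneg_orthant: "closed (nonneg_orthant :: (real ^ 'n) set)"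
  unfolding nonneg_orthant_def
  by (intro closed_Collect_all closed_Collect_le continuous_intros)

lemma convex_nonneg_orthant: "convex (nonneg_orthant :: (real ^ 'n) set)"
  unfolding nonneg_orthant_def convex_def by (auto intro!: add_nonneg_nonneg mult_nonneg_nonneg)

lemma norm_le_neg_inner:
  fixes u y :: "real ^ 'n"
  assumes u: "u \<in> nonneg_orthant" and "0 \<le> c" and y: "\<And>i. y $ i \<le> - c"
  shows "c * norm u \<le> - inner u y"
proof -
  have "c * norm u \<le> c * (\<Sum>i\<in>UNIV. \<bar>u $ i\<bar>)"
    by (intro mult_left_mono norm_le_l1_cart \<open>0 \<le> c\<close>)
  also have "\<dots> = (\<Sum>i\<in>UNIV. u $ i * c)"
    using u by (simp add: sum_distrib_left nonneg_orthant_def mult.commute)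
  also have "\<dots> \<le> (\<Sum>i\<in>UNIV. u $ i * (- y $ i))"
  proof (intro sum_mono mult_left_mono)
    fix i show "c \<le> - y $ i" using y[of i] by simp
  qed (use u in \<open>simp add: nonneg_orthant_def\<close>)
  finally show ?thesis by (simp add: inner_vec_def sum_negf)
qed

text \<open>All \<open>y\<close> near a strictly negative \<open>y0\<close> have entries below a common \<open>-c < 0\<close>, so that points
  of large norm cannot compete with a fixed point \<open>u0\<close> of the set.\<close>

lemma locally_bounded_maximisers:
  fixes L :: "(real ^ 'n) set"
  assumes cl: "closed L" and sub: "L \<subseteq> nonneg_orthant" and ne: "L \<noteq> {}"
    and y0: "y0 \<in> uminus ` pos_orthant"
  shows "\<exists>r>0. \<exists>R. \<forall>y\<in>ball y0 r. \<exists>x\<in>L \<inter> cball 0 R. \<forall>u\<in>L. inner u y \<le> inner x y"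
proof -
  obtain u0 where u0: "u0 \<in> L" using ne by blast
  define c where "c = Min (range (\<lambda>i. - y0 $ i)) / 2"
  have neg: "y0 $ i < 0" for i using y0 by (auto simp: pos_orthant_def)
  have "c > 0" unfolding c_def using neg by simp
  have c: "y0 $ i \<le> - (2 * c)" for i
  proof -
    have "Min (range (\<lambda>i. - y0 $ i)) \<le> - y0 $ i" by (rule Min_le) auto
    then show ?thesis unfolding c_def by linarith
  qed
  define R where "R = norm u0 * (norm y0 + c) / c"
  have "\<exists>x\<in>L \<inter> cball 0 R. \<forall>u\<in>L. inner u y \<le> inner x y" if y: "y \<in> ball y0 c" for y
  proof -
    have ny: "norm (y - y0) < c" using y by (simp add: dist_norm norm_minus_commute)
    have yc: "y $ i \<le> - c" for i
    proof -
      have "\<bar>(y - y0) $ i\<bar> \<le> norm (y - y0)" by (rule component_le_norm_cart)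
      then show ?thesis using c[of i] ny by simp
    qed
    \<comment> \<open>Points at least as good as \<open>u0\<close> lie in the ball, so a maximum over the ball is global.\<close>
    have bound: "u \<in> L \<inter> cball 0 R" if u: "u \<in> L" "inner u0 y \<le> inner u y" for u
    proof -
      have "c * norm u \<le> - inner u y"
        by (rule norm_le_neg_inner) (use u sub yc \<open>c > 0\<close> in auto)
      also have "\<dots> \<le> \<bar>inner u0 y\<bar>" using u by simp
      also have "\<dots> \<le> norm u0 * norm y" by (rule Cauchy_Schwarz_ineq2)
      also have "\<dots> \<le> norm u0 * (norm y0 + c)"
        using ny norm_triangle_sub[of y y0] by (intro mult_left_mono) auto
      finally have "norm u \<le> R" using \<open>c > 0\<close> by (simp add: R_def field_simps)
      with u show ?thesis by simp
    qed
    have "compact (L \<inter> cball 0 R)" by (intro closed_Int_compact cl compact_cball)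
    moreover have u0': "u0 \<in> L \<inter> cball 0 R" using bound u0 by blast
    moreover have "continuous_on (L \<inter> cball 0 R) (\<lambda>u. inner u y)" by (intro continuous_intros)
    ultimately obtain x where x: "x \<in> L \<inter> cball 0 R" "\<And>u. u \<in> L \<inter> cball 0 R \<Longrightarrow> inner u y \<le> inner x y"
      using continuous_attains_sup[of "L \<inter> cball 0 R" "\<lambda>u. inner u y"] by blast
    have "inner u y \<le> inner x y" if "u \<in> L" for u
    proof (cases "inner u0 y \<le> inner u y")
      case True
      then show ?thesis using x(2) bound that by blast
    next
      case False
      then show ?thesis using x(2)[OF u0'] by simp
    qed
    with x(1) show ?thesis by blast
  qed
  with \<open>c > 0\<close> show ?thesis by blast
qed

text \<open>At a minimiser \<open>w\<close> of the convex function below over a convex set, the negative gradient is a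
  linear functional that \<open>w\<close> maximises, and all of its entries are strictly negative.\<close>

lemma exponential_minimiser_exposed:
  fixes C :: "(real ^ 'n) set" and a w :: "real ^ 'n" and N :: real
  defines "\<phi> \<equiv> \<lambda>v. \<Sum>i\<in>UNIV. exp (N * (v $ i - a $ i))"
  assumes C: "convex C" and w: "w \<in> C" and min: "\<And>v. v \<in> C \<Longrightarrow> \<phi> w \<le> \<phi> v" and "N > 0"
  shows "\<exists>y\<in>uminus ` pos_orthant. \<forall>v\<in>C. inner v y \<le> inner w y"
proof
  define g :: "real ^ 'n" where "g = (\<chi> i. exp (N * (w $ i - a $ i)))"
  show "- g \<in> uminus ` pos_orthant" by (simp add: g_def pos_orthant_def)
  show "\<forall>v\<in>C. inner v (- g) \<le> inner w (- g)"
  proof (rule ballI, rule ccontr)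
    fix v assume v: "v \<in> C" and "\<not> inner v (- g) \<le> inner w (- g)"
    then have neg: "inner (v - w) g < 0" by (simp add: inner_diff_left)
    let ?f = "\<lambda>t. \<phi> (w + t *\<^sub>R (v - w))"
    have "(?f has_real_derivative N * inner (v - w) g) (at 0)"
      unfolding \<phi>_def g_def inner_vec_def
      by (auto intro!: derivative_eq_intros simp: sum_distrib_left mult_ac)
    moreover have "N * inner (v - w) g < 0" using neg \<open>N > 0\<close> by (simp add: mult_pos_neg)
    ultimately obtain d where d: "d > 0" "\<And>h. 0 < h \<Longrightarrow> h < d \<Longrightarrow> ?f (0 + h) < ?f 0"
      using DERIV_neg_dec_right[of ?f "N * inner (v - w) g" 0] by blast
    define h where "h = min (d / 2) 1"
    have h: "0 < h" "h < d" "h \<le> 1" using d(1) by (auto simp: h_def)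
    have "(1 - h) *\<^sub>R w + h *\<^sub>R v \<in> C"
      using C v w h unfolding convex_alt by simp
    then have "w + h *\<^sub>R (v - w) \<in> C" by (simp add: algebra_simps)
    from min[OF this] d(2)[OF h(1,2)] show False by simp
  qed
qed

text \<open>For large \<open>N\<close> the function \<open>\<Sum>i. exp (N * (v $ i - a $ i))\<close> is less than \<open>1\<close> at \<open>z\<close>, where
  \<open>a\<close> exceeds \<open>z\<close> by \<open>e\<close> in every entry, and it is greater than \<open>1\<close> as soon as one entry of \<open>v\<close>
  exceeds that of \<open>a\<close>. So it has a minimiser over the closed hull, which lies below \<open>a\<close> and,
  being exposed by a strictly negative functional, belongs to \<open>L\<close>.\<close>

lemma level_point_below_hull_point:
  fixes L :: "(real ^ 'n) set"
  assumes cl: "closed L" and sub: "L \<subseteq> nonneg_orthant"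
    and diff: "\<And>y. y \<in> uminus ` pos_orthant \<Longrightarrow> ereal_differentiable_at (support_function L) y"
    and z: "z \<in> convex hull L" and "e > 0"
  shows "\<exists>w\<in>L. \<forall>i. w $ i \<le> z $ i + e"
proof -
  define C where "C = closure (convex hull L)"
  have "L \<noteq> {}" using z by auto
  have "convex C" unfolding C_def by (intro convex_closure convex_convex_hull)
  have LC: "L \<subseteq> C" unfolding C_def by (rule subset_trans[OF hull_subset closure_subset])
  have C0: "C \<subseteq> nonneg_orthant"
    unfolding C_def
    by (intro closure_minimal hull_minimal sub convex_nonneg_orthant closed_nonneg_orthant)
  have zC: "z \<in> C" unfolding C_def by (rule subsetD[OF closure_subset z])
  define a where "a = z + e *\<^sub>R 1"
  have a: "a $ i = z $ i + e" for i by (simp add: a_def)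
  \<comment> \<open>\<open>\<phi> z\<close> is \<open>n * exp (- n)\<close> for this \<open>N\<close>, where \<open>n\<close> is the dimension.\<close>
  define N where "N = real CARD('n) / e"
  have "N > 0" using \<open>e > 0\<close> by (simp add: N_def)
  define \<phi> :: "real ^ 'n \<Rightarrow> real" where "\<phi> = (\<lambda>v. \<Sum>i\<in>UNIV. exp (N * (v $ i - a $ i)))"
  have \<phi>z: "\<phi> z < 1"
  proof -
    have "real CARD('n) < exp (real CARD('n))"
      using exp_ge_add_one_self[of "real CARD('n)"] by linarith
    then show ?thesis
      using \<open>e > 0\<close> by (simp add: \<phi>_def a N_def exp_minus field_simps)
  qed
  have \<phi>_big: "1 < \<phi> v" if "a $ i < v $ i" for v i
  proof -
    have "1 < exp (N * (v $ i - a $ i))" using that \<open>N > 0\<close> by simp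
    also have "\<dots> \<le> \<phi> v"
      unfolding \<phi>_def by (rule member_le_sum) auto
    finally show ?thesis .
  qed
  define K where "K = C \<inter> cbox 0 a"
  have "compact K" unfolding K_def C_def by (intro closed_Int_compact closed_closure compact_cbox)
  have "z \<in> K" using zC C0 \<open>e > 0\<close> by (auto simp: K_def mem_box_cart nonneg_orthant_def a)
  have "continuous_on K \<phi>" unfolding \<phi>_def by (intro continuous_intros)
  then obtain w where w: "w \<in> K" "\<And>v. v \<in> K \<Longrightarrow> \<phi> w \<le> \<phi> v"
    using continuous_attains_inf[OF \<open>compact K\<close>] \<open>z \<in> K\<close> by blast
  have wC: "w \<in> C" and wa: "w $ i \<le> a $ i" for i using w(1) by (auto simp: K_def mem_box_cart)
  have "\<phi> w \<le> \<phi> v" if v: "v \<in> C" for v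
  proof (cases "v \<in> K")
    case False
    moreover have "\<forall>i. 0 \<le> v $ i" using v C0 by (auto simp: nonneg_orthant_def)
    ultimately obtain i where "a $ i < v $ i"
      using v by (auto simp: K_def mem_box_cart not_le)
    then show ?thesis using \<phi>_big[of i v] w(2)[OF \<open>z \<in> K\<close>] \<phi>z by simp
  qed (rule w(2))
  then obtain y where y: "y \<in> uminus ` pos_orthant" "\<And>v. v \<in> C \<Longrightarrow> inner v y \<le> inner w y"
    using exponential_minimiser_exposed[OF \<open>convex C\<close> wC _ \<open>N > 0\<close>, of a] unfolding \<phi>_def by blast
  have "\<exists>r>0. \<exists>R. \<forall>y'\<in>ball y r. \<exists>x\<in>L \<inter> cball 0 R. \<forall>u\<in>L. inner u y' \<le> inner x y'"
    using locally_bounded_maximisers[OF cl sub \<open>L \<noteq> {}\<close> y(1)] .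
  then obtain x where x: "x \<in> L" "\<And>u. u \<in> L \<Longrightarrow> inner u y \<le> inner x y"
    by (metis IntD1 centre_in_ball)
  have supp: "support_function L y = ereal (inner x y)"
    using support_function_eq_maximum x by blast
  have "inner w y = inner x y"
  proof (rule antisym)
    have "C \<subseteq> {v. inner y v \<le> inner x y}"
      unfolding C_def using x(2)
      by (intro closure_minimal hull_minimal convex_halfspace_le closed_halfspace_le)
        (auto simp: inner_commute)
    then show "inner w y \<le> inner x y" using wC by (auto simp: inner_commute)
    show "inner x y \<le> inner w y" using y(2) x(1) LC by blast
  qed
  then have "w = x"
    using unique_maximiser_if_differentiable[OF diff[OF y(1)]] wC x(1) LC supp unfolding C_def
    by (metis subsetD)
  with x(1) wa a show ?thesis by auto
qed

section \<open>Level sets and quasiconcavity\<close>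

lemma closed_upper_level_set:
  assumes "continuous_on nonneg_orthant F"
  shows "closed (upper_level_set F \<gamma>)"
proof -
  have "upper_level_set F \<gamma> = nonneg_orthant \<inter> F -` {\<gamma>..}"
    by (auto simp: upper_level_set_def)
  then show ?thesis
    using continuous_closed_preimage[OF assms closed_nonneg_orthant closed_atLeast] by simp
qed

text \<open>Since \<open>F\<close> vanishes at the origin, the midpoint \<open>m\<close> of two points at a positive level is not
  the origin, and a strictly negative functional is therefore negative at \<open>m\<close>. This is why moving
  from \<open>m\<close> towards the origin improves on both maximisers.\<close>

lemma strictly_quasiconcave_imp_differentiable:
  fixes F :: "real ^ 'n \<Rightarrow> real"
  assumes cont: "continuous_on nonneg_orthant F" and F0: "F 0 = 0"
    and sqc: "strictly_quasiconcave_on {x \<in> nonneg_orthant. F x > 0} F"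
    and \<gamma>: "\<gamma> \<in> positive_levels F" and y: "y \<in> uminus ` pos_orthant"
  shows "ereal_differentiable_at (support_function (upper_level_set F \<gamma>)) y"
proof -
  define L where "L = upper_level_set F \<gamma>"
  have "\<gamma> > 0" and "L \<noteq> {}" using \<gamma> by (auto simp: positive_levels_def L_def)
  have cl: "closed L" unfolding L_def by (rule closed_upper_level_set[OF cont])
  have sub: "L \<subseteq> nonneg_orthant" by (auto simp: L_def upper_level_set_def)
  have unique: "x = x'"
    if x: "x \<in> L" "\<forall>u\<in>L. inner u y \<le> inner x y" and x': "x' \<in> L" "\<forall>u\<in>L. inner u y \<le> inner x' y"
    for x x'
  proof (rule ccontr)
    assume "x \<noteq> x'"
    define m where "m = (1/2) *\<^sub>R x + (1 - 1/2) *\<^sub>R x'"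
    have "x \<in> {x \<in> nonneg_orthant. F x > 0}" "x' \<in> {x \<in> nonneg_orthant. F x > 0}"
      using x(1) x'(1) \<open>\<gamma> > 0\<close> by (auto simp: L_def upper_level_set_def)
    moreover have "(1/2::real) \<in> {0<..<1}" by simp
    ultimately have "min (F x) (F x') < F m"
      using sqc \<open>x \<noteq> x'\<close> unfolding strictly_quasiconcave_on_def m_def by blast
    then have Fm: "\<gamma> < F m" using x(1) x'(1) by (auto simp: L_def upper_level_set_def)
    have m0: "m \<in> nonneg_orthant"
      unfolding m_def by (rule convexD[OF convex_nonneg_orthant]) (use x(1) x'(1) sub in auto)
    have "inner x y = inner x' y" using x x' by (meson antisym)
    then have my: "inner m y = inner x y" by (simp add: m_def inner_add_left)
    have "inner m y < 0"
    proof -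
      have "m \<noteq> 0" using Fm F0 \<open>\<gamma> > 0\<close> by auto
      then obtain i where "m $ i \<noteq> 0" by (auto simp: vec_eq_iff)
      moreover have "0 \<le> m $ j" "y $ j < 0" for j
        using m0 y by (auto simp: nonneg_orthant_def pos_orthant_def)
      ultimately have "0 < (\<Sum>i\<in>UNIV. m $ i * (- y $ i))"
        by (intro sum_pos2[of _ i]) (auto simp: less_le mult_nonneg_nonpos2 mult_le_0_iff less_imp_le)
      then show ?thesis by (simp add: inner_vec_def sum_negf)
    qed
    have "continuous_on {0..1} (\<lambda>t. F (t *\<^sub>R m))"
      by (rule continuous_on_compose2[OF cont])
        (use m0 in \<open>auto intro!: continuous_intros simp: nonneg_orthant_def\<close>)
    then have "((\<lambda>t. F (t *\<^sub>R m)) \<longlongrightarrow> F (1 *\<^sub>R m)) (at 1 within {0..1})"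
      unfolding continuous_on_def by (rule bspec) simp
    then have "\<forall>\<^sub>F t in at_left 1. \<gamma> < F (t *\<^sub>R m)"
      using Fm by (auto simp: at_within_Icc_at_left dest: order_tendstoD(1))
    moreover have "\<forall>\<^sub>F t in at_left (1::real). t \<in> {0<..<1}"
      by (rule eventually_at_left_real) simp
    ultimately have "\<forall>\<^sub>F t in at_left 1. \<gamma> < F (t *\<^sub>R m) \<and> t \<in> {0<..<1}"
      by (rule eventually_conj)
    from eventually_happens'[OF _ this] obtain t where t: "\<gamma> < F (t *\<^sub>R m)" "0 < t" "t < 1"
      by (auto simp: trivial_limit_at_left_real)
    \<comment> \<open>The functional is negative at \<open>m\<close>, so shrinking \<open>m\<close> increases it.\<close>
    have "t *\<^sub>R m \<in> L"
      using t m0 by (auto simp: L_def upper_level_set_def nonneg_orthant_def)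
    then have "t * inner m y \<le> inner m y" using x(2) my by fastforce
    moreover have "inner m y < t * inner m y" using \<open>inner m y < 0\<close> t(3) by simp
    ultimately show False by simp
  qed
  obtain r R where "r > 0"
    "\<And>y'. y' \<in> ball y r \<Longrightarrow> \<exists>x\<in>L \<inter> cball 0 R. \<forall>u\<in>L. inner u y' \<le> inner x y'"
    using locally_bounded_maximisers[OF cl sub \<open>L \<noteq> {}\<close> y] by blast
  from differentiable_if_unique_maximiser[OF cl this unique] show ?thesis
    unfolding L_def by blast
qed

text \<open>A convex combination \<open>z\<close> of two points of a level set has a point of the level set below
  \<open>z + e *\<^sub>R 1\<close> for each \<open>e > 0\<close>. Monotonicity bounds \<open>F\<close> from below at these points, and the
  bound passes to \<open>z\<close> as \<open>e\<close> tends to \<open>0\<close>. Only positive levels matter because \<open>F\<close> is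
  nonnegative.\<close>

lemma differentiable_imp_quasiconcave:
  fixes F :: "real ^ 'n \<Rightarrow> real"
  assumes nonneg: "\<And>x. x \<in> nonneg_orthant \<Longrightarrow> F x \<ge> 0"
    and cont: "continuous_on nonneg_orthant F"
    and mono: "\<And>x x'. \<lbrakk>x \<in> nonneg_orthant; x' \<in> nonneg_orthant; x - x' \<in> nonneg_orthant\<rbrakk>
           \<Longrightarrow> F x \<ge> F x'"
    and diff: "\<And>\<gamma> y. \<gamma> \<in> positive_levels F \<Longrightarrow> y \<in> uminus ` pos_orthant
           \<Longrightarrow> ereal_differentiable_at (support_function (upper_level_set F \<gamma>)) y"
  shows "quasiconcave_on nonneg_orthant F"
  unfolding quasiconcave_on_def
proof (intro ballI)
  fix x x' :: "real ^ 'n" and t :: real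
  assume x: "x \<in> nonneg_orthant" and x': "x' \<in> nonneg_orthant" and t: "t \<in> {0<..<1}"
  define \<gamma> where "\<gamma> = min (F x) (F x')"
  define z where "z = t *\<^sub>R x + (1 - t) *\<^sub>R x'"
  have z0: "z \<in> nonneg_orthant"
    unfolding z_def by (rule convexD[OF convex_nonneg_orthant x x']) (use t in auto)
  have "\<gamma> \<le> F z"
  proof (cases "\<gamma> > 0")
    case False
    then show ?thesis using nonneg[OF z0] by simp
  next
    case True
    define L where "L = upper_level_set F \<gamma>"
    have xL: "x \<in> L" "x' \<in> L" using x x' by (auto simp: L_def upper_level_set_def \<gamma>_def)
    then have "\<gamma> \<in> positive_levels F" using True by (auto simp: positive_levels_def L_def)
    note diffL = diff[OF this, folded L_def]
    have sub: "L \<subseteq> nonneg_orthant" by (auto simp: L_def upper_level_set_def)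
    have cl: "closed L" unfolding L_def by (rule closed_upper_level_set[OF cont])
    have zL: "z \<in> convex hull L"
      unfolding z_def by (rule convexD[OF convex_convex_hull]) (use xL t hull_inc in auto)
    have above: "\<gamma> \<le> F (z + e *\<^sub>R 1)" if e: "e > 0" for e
    proof -
      obtain w where w: "w \<in> L" "\<forall>i. w $ i \<le> z $ i + e"
        using level_point_below_hull_point[OF cl sub diffL zL e] by blast
      have "F w \<le> F (z + e *\<^sub>R 1)"
        by (rule mono) (use w sub z0 e in \<open>auto simp: nonneg_orthant_def\<close>)
      with w(1) show ?thesis by (auto simp: L_def upper_level_set_def)
    qed
    have "continuous_on {0..} (\<lambda>e. F (z + e *\<^sub>R 1))"
      by (rule continuous_on_compose2[OF cont])
        (use z0 in \<open>auto intro!: continuous_intros simp: nonneg_orthant_def\<close>)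
    then have "((\<lambda>e. F (z + e *\<^sub>R 1)) \<longlongrightarrow> F (z + 0 *\<^sub>R 1)) (at 0 within {0..})"
      unfolding continuous_on_def by (rule bspec) simp
    then have "((\<lambda>e. F (z + e *\<^sub>R 1)) \<longlongrightarrow> F z) (at_right 0)"
      by (simp add: at_within_Ici_at_right)
    then show ?thesis
    proof (rule tendsto_lowerbound)
      show "\<forall>\<^sub>F e in at_right 0. \<gamma> \<le> F (z + e *\<^sub>R 1)"
        using eventually_at_right_less[of 0] by eventually_elim (rule above)
    qed simp
  qed
  then show "min (F x) (F x') \<le> F (t *\<^sub>R x + (1 - t) *\<^sub>R x')" by (simp add: \<gamma>_def z_def)
qed

theorem corollary23:
  fixes F :: "real ^ 'n \<Rightarrow> real"
  assumes "CARD('n) \<ge> 2"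
    and "\<And>x. x \<in> nonneg_orthant \<Longrightarrow> F x \<ge> 0"
    and "continuous_on nonneg_orthant F"
    and "F 0 = 0"
    and "\<And>x x'. \<lbrakk>x \<in> nonneg_orthant; x' \<in> nonneg_orthant; x - x' \<in> nonneg_orthant\<rbrakk>
           \<Longrightarrow> F x \<ge> F x'"
  shows "(strictly_quasiconcave_on {x \<in> nonneg_orthant. F x > 0} F \<longrightarrow>
           (\<forall>\<gamma>\<in>positive_levels F. \<forall>y\<in>uminus ` pos_orthant.
              ereal_differentiable_at (support_function (upper_level_set F \<gamma>)) y))
       \<and> ((\<forall>x\<in>nonneg_orthant. \<forall>x'\<in>nonneg_orthant.
              x - x' \<in> nonneg_orthant - {0} \<and> F x' > 0 \<longrightarrow> F x > F x') \<and>
          (\<forall>\<gamma>\<in>positive_levels F. \<forall>y\<in>uminus ` pos_orthant.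
              ereal_differentiable_at (support_function (upper_level_set F \<gamma>)) y)
          \<longrightarrow> quasiconcave_on nonneg_orthant F)"
  using strictly_quasiconcave_imp_differentiable[OF assms(3,4)]
    differentiable_imp_quasiconcave[OF assms(2,3,5)] by blast

end
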